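(* For every fixed integer $k>2$ and every positive integer $n$, \[P(n,k)\le \begin{cases} 2^{n} & \text{if } k\equiv 1 \pmod 2,\\[2pt] 2^{H\left(\frac{k-2}{2k-2},\,\frac{k-2}{2k-2},\,\frac{2}{2k-2}\right)n} & \text{if } k\equiv 0 \pmod 2.\end{cases}\]
   Context: A permutation of $[n]=\{1,2,\ldots,n\}$ is regarded as a linear ordering (sequence) of the elements of $[n]$. Two permutations of $[n]$ are $k$-neighbor separated if there are two elements of $[n]$ that are neighbors (occupy consecutive positions) in one of the permutations and are separated by exactly $k-2$ other elements in the other permutation (i.e. their positions there differ by exactly $k-1$). $P(n,k)$ denotes the maximal number of pairwise $k$-neighbor separated permutations of $[n]$ (the maximum size of a family in which any two distinct members are $k$-neighbor separated). $H(x_1,x_2,x_3):=\sum_{i=1}^{3}-x_i\log_2 x_i$ is the entropy function. *)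

theory Defs
  imports Complex_Main "HOL-Combinatorics.Multiset_Permutations"
begin

text \<open>A permutation of \<open>{1..n}\<close>, viewed as a linear ordering, is a list in
  \<^term>\<open>permutations_of_set {1..n}\<close>, read from left to right.\<close>

definition positions_differ_by :: "nat \<Rightarrow> 'a list \<Rightarrow> 'a \<Rightarrow> 'a \<Rightarrow> bool" where
  "positions_differ_by d xs a b \<longleftrightarrow>
     (\<exists>i. i + d < length xs \<and> (xs ! i = a \<and> xs ! (i + d) = b \<or> xs ! i = b \<and> xs ! (i + d) = a))"

text \<open>Being separated by exactly \<open>k - 2\<close> other elements means that the positions differ by
  \<open>k - 1\<close>; the subtraction is only meaningful for \<open>k \<ge> 1\<close>.\<close>

definition neighbor_separated :: "nat \<Rightarrow> 'a list \<Rightarrow> 'a list \<Rightarrow> bool" where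
  "neighbor_separated k xs ys \<longleftrightarrow>
     (\<exists>a b. positions_differ_by 1 xs a b \<and> positions_differ_by (k - 1) ys a b
          \<or> positions_differ_by 1 ys a b \<and> positions_differ_by (k - 1) xs a b)"

definition neighbor_separated_families :: "nat \<Rightarrow> nat \<Rightarrow> nat list set set" where
  "neighbor_separated_families n k =
     {F. F \<subseteq> permutations_of_set {1..n} \<and> pairwise (neighbor_separated k) F}"

definition P :: "nat \<Rightarrow> nat \<Rightarrow> nat" where
  "P n k = Max (card ` neighbor_separated_families n k)"

text \<open>The maximum is attained: it is taken over a finite nonempty set.\<close>

lemma finite_neighbor_separated_families: "finite (neighbor_separated_families n k)"
  unfolding neighbor_separated_families_def
  by (rule finite_subset[of _ "Pow (permutations_of_set {1..n})"]) auto

lemma neighbor_separated_families_nonempty: "neighbor_separated_families n k \<noteq> {}"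
proof -
  have "{} \<in> neighbor_separated_families n k"
    by (simp add: neighbor_separated_families_def)
  then show ?thesis by blast
qed

definition H :: "real \<Rightarrow> real \<Rightarrow> real \<Rightarrow> real" where
  "H x1 x2 x3 = - x1 * log 2 x1 + - x2 * log 2 x2 + - x3 * log 2 x3"

end

theory Submission
  imports Defs "HOL-Library.FuncSet"
begin

text \<open>
  The bound comes from a weighted count of colourings. Fix an infinite word \<open>c\<close> of colours in which
  consecutive letters differ while letters at distance \<open>k - 1\<close> agree. Writing \<open>c\<close> along a permutation
  colours its elements, so that each permutation yields a colouring of \<open>{1..n}\<close>. If two permutations
  had the same colouring and were \<open>k\<close>-neighbor separated, the two witnessing elements would have
  different colours (neighbors in one) and equal colours (distance \<open>k - 1\<close> in the other); hence a
  \<open>k\<close>-neighbor separated family injects into the colourings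
  (\<open>coloring_along_inj_on\<close>).

  All colourings obtained in this way have the same colour class sizes. Giving the colours weights
  that sum to \<open>1\<close>, and a colouring the product of the weights of its values, they therefore all get
  the same weight \<open>\<Prod>i<n. w (c i)\<close>, whereas the weights of all colourings of \<open>{1..n}\<close> add up to \<open>1\<close>. So the family
  has at most \<open>1 / (\<Prod>i<n. w (c i))\<close> members (\<open>card_mult_word_weight_le_1\<close>).

  For odd \<open>k\<close> the alternating word on two colours of weight \<open>1/2\<close> gives \<open>2 ^ n\<close>. For even \<open>k\<close> the
  number \<open>k - 1\<close> is odd, and the alternation is repaired by a third colour in every \<open>(k - 1)\<close>-st
  place. The weights are the frequencies of the colours in this word, so that the
  weight of a colouring is \<open>2\<close> to the power of minus \<open>n\<close> times the entropy, up to rounding. Rounding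
  helps: the third colour is the last letter of each period, so it occurs at most its proportional
  number of times, and no colour is lighter than it.
\<close>

section \<open>Colourings obtained by writing a word along a permutation\<close>

definition coloring_along :: "(nat \<Rightarrow> 'c) \<Rightarrow> 'a list \<Rightarrow> 'a \<Rightarrow> 'c" where
  "coloring_along c xs = (\<lambda>x\<in>set xs. c (inv_into {..<length xs} ((!) xs) x))"

lemma coloring_along_nth:
  assumes "distinct xs" "i < length xs"
  shows "coloring_along c xs (xs ! i) = c i"
  using assms by (simp add: coloring_along_def inj_on_nth)

lemma coloring_along_PiE:
  assumes "\<And>i. c i \<in> C"
  shows "coloring_along c xs \<in> set xs \<rightarrow>\<^sub>E C"
  using assms by (auto simp: coloring_along_def)

lemma prod_coloring_along:
  fixes w :: "'c \<Rightarrow> 'b::comm_monoid_mult"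
  assumes "distinct xs"
  shows "(\<Prod>x\<in>set xs. w (coloring_along c xs x)) = (\<Prod>i<length xs. w (c i))"
proof -
  have "bij_betw ((!) xs) {..<length xs} (set xs)"
    using assms by (simp add: bij_betw_nth)
  then have "(\<Prod>x\<in>set xs. w (coloring_along c xs x))
      = (\<Prod>i<length xs. w (coloring_along c xs (xs ! i)))"
    by (rule prod.reindex_bij_betw[symmetric])
  also have "\<dots> = (\<Prod>i<length xs. w (c i))"
    using assms by (intro prod.cong) (auto simp: coloring_along_nth)
  finally show ?thesis .
qed

lemma coloring_along_neq_at_distance_1:
  assumes "\<And>i. c (Suc i) \<noteq> c i" "distinct xs" "positions_differ_by 1 xs a b"
  shows "coloring_along c xs a \<noteq> coloring_along c xs b"
  using assms unfolding positions_differ_by_def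
  by (metis Suc_eq_plus1 Suc_lessD coloring_along_nth)

lemma coloring_along_eq_at_period:
  assumes "\<And>i. c (i + d) = c i" "distinct xs" "positions_differ_by d xs a b"
  shows "coloring_along c xs a = coloring_along c xs b"
  using assms unfolding positions_differ_by_def
  by (metis add_lessD1 coloring_along_nth)

text \<open>The two witnesses of separation would be coloured both alike and differently.\<close>

lemma coloring_along_inj_on:
  assumes "\<And>i. c (Suc i) \<noteq> c i" "\<And>i. c (i + (k - 1)) = c i"
    and "\<And>xs. xs \<in> F \<Longrightarrow> distinct xs" "pairwise (neighbor_separated k) F"
  shows "inj_on (coloring_along c) F"
proof (rule inj_onI, rule ccontr)
  fix xs ys
  assume *: "xs \<in> F" "ys \<in> F" "coloring_along c xs = coloring_along c ys" "xs \<noteq> ys"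
  then have "neighbor_separated k xs ys"
    using assms(4) by (auto simp: pairwise_def)
  then show False
    unfolding neighbor_separated_def
    using * coloring_along_neq_at_distance_1[of c, OF assms(1)]
      coloring_along_eq_at_period[of c, OF assms(2)] assms(3)
    by metis
qed

section \<open>The weighted count\<close>

text \<open>The total weight of all colourings is the expanded product \<open>(\<Sum>y\<in>C. w y) ^ n = 1\<close>, and the
  family accounts for \<open>card F\<close> distinct colourings of equal weight.\<close>

lemma card_mult_word_weight_le_1:
  fixes w :: "'c \<Rightarrow> real"
  assumes "F \<in> neighbor_separated_families n k"
    and "\<And>i. c (Suc i) \<noteq> c i" "\<And>i. c (i + (k - 1)) = c i"
    and "finite C" "\<And>i. c i \<in> C" "\<And>y. y \<in> C \<Longrightarrow> 0 \<le> w y" "sum w C = 1"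
  shows "real (card F) * (\<Prod>i<n. w (c i)) \<le> 1"
proof -
  define weight where "weight f = (\<Prod>x\<in>{1..n}. w (f x))" for f
  have F: "distinct xs" "set xs = {1..n}" "length xs = n" if "xs \<in> F" for xs
  proof -
    have "xs \<in> permutations_of_set {1..n}"
      using that assms(1) by (auto simp: neighbor_separated_families_def)
    then show "distinct xs" "set xs = {1..n}" "length xs = n"
      by (auto dest: permutations_of_setD simp: length_finite_permutations_of_set)
  qed
  have inj: "inj_on (coloring_along c) F"
    using assms(1-3) F(1)
    by (intro coloring_along_inj_on) (auto simp: neighbor_separated_families_def)
  have "weight (coloring_along c xs) = (\<Prod>i<n. w (c i))" if "xs \<in> F" for xs
    using prod_coloring_along[of xs w c] F[OF that] by (simp add: weight_def)
  then have "real (card F) * (\<Prod>i<n. w (c i)) = (\<Sum>xs\<in>F. weight (coloring_along c xs))"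
    by simp
  also have "\<dots> = sum weight (coloring_along c ` F)"
    using inj by (simp add: sum.reindex)
  also have "\<dots> \<le> sum weight ({1..n} \<rightarrow>\<^sub>E C)"
  proof (rule sum_mono2)
    show "finite ({1..n} \<rightarrow>\<^sub>E C)"
      using assms(4) by (intro finite_PiE) auto
    show "coloring_along c ` F \<subseteq> {1..n} \<rightarrow>\<^sub>E C"
      using coloring_along_PiE[of c C, OF assms(5)] F(2) by fastforce
    show "0 \<le> weight f" if "f \<in> ({1..n} \<rightarrow>\<^sub>E C) - coloring_along c ` F" for f
      unfolding weight_def using that assms(6) by (auto intro!: prod_nonneg simp: PiE_mem)
  qed
  also have "\<dots> = (\<Prod>x\<in>{1..n}. sum w C)"
    unfolding weight_def using assms(4) by (intro prod_sum_PiE[symmetric]) auto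
  also have "\<dots> = 1"
    using assms(7) by simp
  finally show ?thesis .
qed

lemma P_attained: "\<exists>F\<in>neighbor_separated_families n k. P n k = card F"
proof -
  have "P n k \<in> card ` neighbor_separated_families n k"
    unfolding P_def
    by (rule Max_in) (auto simp: finite_neighbor_separated_families neighbor_separated_families_nonempty)
  then show ?thesis by auto
qed

section \<open>Odd \<open>k\<close>: the alternating word\<close>

lemma P_le_power_2:
  assumes "odd k"
  shows "real (P n k) \<le> 2 ^ n"
proof -
  obtain F where F: "F \<in> neighbor_separated_families n k" "P n k = card F"
    using P_attained by blast
  have "real (card F) * (\<Prod>i<n. 1/2) \<le> 1"
    by (rule card_mult_word_weight_le_1[OF F(1), where c = even and C = UNIV and w = "\<lambda>_. 1/2"])
      (use assms in auto)
  then show ?thesis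
    by (simp add: F(2) field_simps)
qed

section \<open>Even \<open>k\<close>: a third colour once per period\<close>

text \<open>The colour \<open>2\<close> sits at the end of a period rather than at its start, so that a prefix of length
  \<open>n\<close> contains it \<open>n div m\<close> times, rounding down.\<close>

definition marked_word :: "nat \<Rightarrow> nat \<Rightarrow> nat" where
  "marked_word m i = (if i mod m = m - 1 then 2 else i mod m mod 2)"

lemma marked_word_Suc_neq:
  assumes "m > 1"
  shows "marked_word m (Suc i) \<noteq> marked_word m i"
proof (cases "Suc (i mod m) = m")
  case True
  then show ?thesis
    using assms by (auto simp: marked_word_def mod_Suc)
next
  case False
  then have "Suc i mod m = Suc (i mod m)"
    by (simp add: mod_Suc)
  moreover have "i mod m \<noteq> m - 1"
    using False assms by simp
  moreover have "Suc j mod 2 \<noteq> j mod 2" and "j mod 2 \<noteq> 2" for j :: nat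
    by presburger+
  ultimately show ?thesis
    by (auto simp: marked_word_def)
qed

lemma prod_marked_word:
  fixes w :: "nat \<Rightarrow> real"
  assumes "m > 0" "w 1 = w 0"
  shows "(\<Prod>i<n. w (marked_word m i)) = w 0 ^ (n - n div m) * w 2 ^ (n div m)"
proof (induction n)
  case (Suc n)
  show ?case
  proof (cases "Suc (n mod m) = m")
    case True
    then have "Suc n div m = Suc (n div m)"
      by (simp add: div_Suc mod_Suc)
    moreover have "marked_word m n = 2"
      using True by (auto simp: marked_word_def)
    ultimately show ?thesis
      using Suc by simp
  next
    case False
    then have "Suc n div m = n div m"
      using assms by (simp add: div_Suc mod_Suc)
    moreover have "w (marked_word m n) = w 0"
      using False assms by (auto simp: marked_word_def mod_2_eq_odd)
    moreover have "Suc n - n div m = Suc (n - n div m)"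
      by (simp add: Suc_diff_le)
    ultimately show ?thesis
      using Suc by simp
  qed
qed simp

text \<open>The first two colours share the weight \<open>p\<close>, so only the number \<open>r\<close> of occurrences of the third
  matters. If \<open>r\<close> were exactly \<open>q * n\<close>, there would be equality; fewer factors \<open>q\<close> in favour of
  factors \<open>p \<ge> q\<close> can only increase the product.\<close>

lemma entropy_le_log_weight:
  fixes p q :: real
  assumes "0 < q" "q \<le> p" "p + p + q = 1" "real r \<le> q * real n" "r \<le> n"
  shows "1 \<le> p ^ (n - r) * q ^ r * 2 powr (H p p q * real n)"
proof -
  have "0 \<le> (q * real n - real r) * (log 2 p - log 2 q)"
    using assms by (intro mult_nonneg_nonneg) auto
  \<comment> \<open>The last summand vanishes; it makes the step an identity between polynomials.\<close>
  also have "\<dots> = real (n - r) * log 2 p + real r * log 2 q + H p p q * real n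
      - (1 - (p + p + q)) * real n * log 2 p"
    using assms(5) by (simp add: H_def algebra_simps)
  also have "\<dots> = log 2 (p ^ (n - r) * q ^ r * 2 powr (H p p q * real n))"
    using assms by (simp add: log_mult log_nat_power)
  finally show ?thesis
    using assms by (subst (asm) zero_le_log_cancel_iff) auto
qed

lemma P_le_entropy:
  assumes "k \<ge> 4"
  defines "p \<equiv> (real k - 2) / (2 * real k - 2)" and "q \<equiv> 2 / (2 * real k - 2)"
  shows "real (P n k) \<le> 2 powr (H p p q * real n)"
proof -
  obtain F where F: "F \<in> neighbor_separated_families n k" "P n k = card F"
    using P_attained by blast
  define m where "m = k - 1"
  define w :: "nat \<Rightarrow> real" where "w y = (if y = 2 then q else p)" for y
  have q: "q = 1 / real m"
    using assms(1) by (simp add: q_def m_def field_simps)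
  have "0 < q" "q \<le> p"
    using assms(1) by (auto simp: p_def q_def intro!: divide_right_mono)
  moreover have "p + p + q = ((real k - 2) + (real k - 2) + 2) / (2 * real k - 2)"
    by (simp only: p_def q_def add_divide_distrib)
  then have "p + p + q = 1"
    using assms(1) by simp
  ultimately have pq: "0 < q" "q \<le> p" "p + p + q = 1"
    by auto
  have "real (card F) * (\<Prod>i<n. w (marked_word m i)) \<le> 1"
  proof (rule card_mult_word_weight_le_1[OF F(1), where c = "marked_word m" and C = "{0, 1, 2}"])
    show "marked_word m (Suc i) \<noteq> marked_word m i" for i
      using assms(1) by (intro marked_word_Suc_neq) (simp add: m_def)
    show "marked_word m (i + (k - 1)) = marked_word m i" for i
      by (simp add: marked_word_def m_def)
    show "marked_word m i \<in> {0, 1, 2}" for i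
      by (auto simp: marked_word_def)
  qed (use pq in \<open>auto simp: w_def\<close>)
  also have "(\<Prod>i<n. w (marked_word m i)) = p ^ (n - n div m) * q ^ (n div m)"
    using prod_marked_word[of m w n] assms(1) by (simp add: w_def m_def)
  finally have weight: "real (card F) * (p ^ (n - n div m) * q ^ (n div m)) \<le> 1" .
  have "real (n div m) \<le> q * real n"
    using of_nat_div_le_of_nat[of n m, where ?'a = real] by (simp add: q)
  then have "1 \<le> p ^ (n - n div m) * q ^ (n div m) * 2 powr (H p p q * real n)"
    using pq by (intro entropy_le_log_weight) auto
  then have "real (card F) * 1
      \<le> real (card F) * (p ^ (n - n div m) * q ^ (n div m) * 2 powr (H p p q * real n))"
    by (intro mult_left_mono) auto
  also have "\<dots> = (real (card F) * (p ^ (n - n div m) * q ^ (n div m))) * 2 powr (H p p q * real n)"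
    by simp
  also have "\<dots> \<le> 1 * 2 powr (H p p q * real n)"
    using weight by (intro mult_right_mono) auto
  finally show ?thesis
    by (simp add: F(2))
qed

section \<open>The upper bound\<close>

theorem theorem1p7:
  fixes n k :: nat
  assumes "k > 2" and "n > 0"
  shows "real (P n k) \<le>
    (if odd k then 2 ^ n
     else 2 powr (H ((real k - 2) / (2 * real k - 2)) ((real k - 2) / (2 * real k - 2))
                    (2 / (2 * real k - 2)) * real n))"
proof (cases "odd k")
  case True
  then show ?thesis
    using P_le_power_2 by simp
next
  case False
  then have "k \<ge> 4"
    using assms(1) by presburger
  then show ?thesis
    using P_le_entropy[of k n] False by simp
qed

end
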